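(* Let $K$ be a field, $\alpha$ an automorphism of $K$, $K[x;\alpha]$ the Ore extension of $K$ by $\alpha$, $K(x;\alpha)$ its division ring of fractions and $K[\![x;\alpha]\!]$ the power series ring into which $K[x;\alpha]$ embeds. A power series $\sum_{i\ge 0} a_i x^i \in K[\![x;\alpha]\!]$ represents a rational function $Q^{-1}P \in K(x;\alpha)$ if and only if there exist an integer $n \geq 1$ and constants $c_1,\dots,c_n \in K$ (some of which may be zero) such that for all $i \geq 0$ the coefficients satisfy the linear recurrence relation $$a_{i+n} = c_1\alpha(a_{i+(n-1)}) + c_2\alpha^2(a_{i+(n-2)}) + \dots + c_n\alpha^n(a_i).$$ If this is the case, then (the series represents $Q^{-1}P$ where) $P$ is a polynomial of degree $\leq n-1$ and $Q = 1 - \sum_{i=1}^n c_i x^i$.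
   Context: $K[x;\alpha]$ is the free left $K$-module with basis $1,x,x^2,\dots$ and multiplication determined by $xr = \alpha(r)x$ for $r \in K$. $K[\![x;\alpha]\!]$ consists of formal series $\sum_{i\geq 0} a_i x^i$ (coefficients on the left) with the same commutation rule. The division ring $K(x;\alpha)$ embeds in the ring $K(\!(x;\alpha)\!)$ of Laurent series $\sum_{i\ge m} a_i x^i$, $m\in\mathbb{Z}$, which also contains $K[\![x;\alpha]\!]$; a power series "represents" a rational function $Q^{-1}P$ (with $P,Q\in K[x;\alpha]$, $Q\neq 0$) if they are equal in $K(\!(x;\alpha)\!)$. *)

theory Defs
  imports
    "HOL-Algebra.Subrings"
    "HOL-Computational_Algebra.Computational_Algebra"
begin

section \<open>Automorphisms of a field and their integer powers\<close>

locale field_automorphism =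
  fixes \<alpha> :: "'a::field \<Rightarrow> 'a"
  assumes bij: "bij \<alpha>"
    and add: "\<alpha> (x + y) = \<alpha> x + \<alpha> y"
    and mult: "\<alpha> (x * y) = \<alpha> x * \<alpha> y"

definition aut_power :: "('a \<Rightarrow> 'a) \<Rightarrow> int \<Rightarrow> 'a \<Rightarrow> 'a" where
  "aut_power \<alpha> i =
     (if i \<ge> 0 then \<alpha> ^^ nat i else (inv_into UNIV \<alpha>) ^^ nat (- i))"


section \<open>Skew polynomials, power series and Laurent series\<close>

text \<open>
  The additive groups of $K[x;\alpha]$, $K[\![x;\alpha]\!]$ and $K(\!(x;\alpha)\!)$ are those of
  the library types \<^typ>\<open>'a poly\<close>, \<^typ>\<open>'a fps\<close> and \<^typ>\<open>'a fls\<close>, with coefficients written on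
  the left of the powers of $x$. Only the multiplication differs from the library's: it obeys
  $(a x^i)(b x^j) = a \alpha^i(b) x^{i+j}$. In particular the type class operations \<open>*\<close>,
  \<open>inverse\<close> and \<open>/\<close> of these types are not the ones meant below.
\<close>

definition skew_poly_times :: "('a::field \<Rightarrow> 'a) \<Rightarrow> 'a poly \<Rightarrow> 'a poly \<Rightarrow> 'a poly" where
  "skew_poly_times \<alpha> p q =
     (\<Sum>i\<le>degree p. \<Sum>j\<le>degree q. monom (coeff p i * (\<alpha> ^^ i) (coeff q j)) (i + j))"

definition skew_fps_times :: "('a::field \<Rightarrow> 'a) \<Rightarrow> 'a fps \<Rightarrow> 'a fps \<Rightarrow> 'a fps" where
  "skew_fps_times \<alpha> f g =
     Abs_fps (\<lambda>n. \<Sum>i=0..n. fps_nth f i * (\<alpha> ^^ i) (fps_nth g (n - i)))"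

definition skew_fls_times :: "('a::field \<Rightarrow> 'a) \<Rightarrow> 'a fls \<Rightarrow> 'a fls \<Rightarrow> 'a fls" where
  "skew_fls_times \<alpha> f g =
     Abs_fls (\<lambda>n. \<Sum>i=fls_subdegree f..n - fls_subdegree g.
                     fls_nth f i * aut_power \<alpha> i (fls_nth g (n - i)))"

definition skew_poly :: "('a::field \<Rightarrow> 'a) \<Rightarrow> 'a poly ring" where
  "skew_poly \<alpha> = \<lparr>carrier = UNIV, monoid.mult = skew_poly_times \<alpha>, one = 1, zero = 0, add = (+)\<rparr>"

definition skew_fps :: "('a::field \<Rightarrow> 'a) \<Rightarrow> 'a fps ring" where
  "skew_fps \<alpha> = \<lparr>carrier = UNIV, monoid.mult = skew_fps_times \<alpha>, one = 1, zero = 0, add = (+)\<rparr>"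

definition skew_fls :: "('a::field \<Rightarrow> 'a) \<Rightarrow> 'a fls ring" where
  "skew_fls \<alpha> = \<lparr>carrier = UNIV, monoid.mult = skew_fls_times \<alpha>, one = 1, zero = 0, add = (+)\<rparr>"

definition poly_to_fls :: "'a::field poly \<Rightarrow> 'a fls" where
  "poly_to_fls p = fps_to_fls (fps_of_poly p)"


section \<open>Skew rational functions\<close>

text \<open>
  $Q^{-1}P$, formed in $K(\!(x;\alpha)\!)$. The division ring of fractions $K(x;\alpha)$ is
  identified with its image in $K(\!(x;\alpha)\!)$, which is the set of all these left fractions.
\<close>

definition skew_fraction :: "('a::field \<Rightarrow> 'a) \<Rightarrow> 'a poly \<Rightarrow> 'a poly \<Rightarrow> 'a fls" where
  "skew_fraction \<alpha> Q P =
     inv\<^bsub>skew_fls \<alpha>\<^esub> (poly_to_fls Q) \<otimes>\<^bsub>skew_fls \<alpha>\<^esub> poly_to_fls P"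

definition skew_ratfun :: "('a::field \<Rightarrow> 'a) \<Rightarrow> 'a fls ring" where
  "skew_ratfun \<alpha> = (skew_fls \<alpha>) \<lparr>carrier := {skew_fraction \<alpha> Q P | Q P. Q \<noteq> 0}\<rparr>"

definition represents :: "'a::field fps \<Rightarrow> 'a fls \<Rightarrow> bool" where
  "represents A r \<longleftrightarrow> fps_to_fls A = r"


section \<open>The rings are as intended\<close>

context field_automorphism opening fps_syntax
begin

lemma inj: "inj \<alpha>" and surj: "surj \<alpha>"
  using bij by (auto simp: bij_def)

lemma zero [simp]: "\<alpha> 0 = 0"
  using add[of 0 0] by (metis add.right_neutral add_left_cancel)

lemma one [simp]: "\<alpha> 1 = 1"
proof -
  have "\<alpha> 1 \<noteq> 0" using inj zero by (metis injD zero_neq_one)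
  thus ?thesis using mult[of 1 1] by simp
qed

abbreviation pw :: "int \<Rightarrow> 'a \<Rightarrow> 'a" where "pw \<equiv> aut_power \<alpha>"

lemma pw_0 [simp]: "pw 0 x = x"
  by (simp add: aut_power_def)

lemma pw_of_nat: "pw (int n) = \<alpha> ^^ n"
  by (simp add: aut_power_def)

lemma pw_Suc: "pw (i + 1) x = \<alpha> (pw i x)"
proof (cases "i \<ge> 0")
  case True
  hence "nat (i + 1) = Suc (nat i)" by simp
  thus ?thesis using True by (simp add: aut_power_def)
next
  case False
  then obtain n where n: "nat (- i) = Suc n" by (metis gr0_implies_Suc neg_0_less_iff_less not_le zero_less_nat_eq)
  hence i: "i + 1 = - int n" by linarith
  hence "pw (i + 1) x = (inv_into UNIV \<alpha> ^^ n) x" by (auto simp: aut_power_def)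
  moreover have "pw i x = inv_into UNIV \<alpha> ((inv_into UNIV \<alpha> ^^ n) x)"
    using False n by (simp add: aut_power_def)
  ultimately show ?thesis by (simp add: surj_f_inv_f[OF surj])
qed

lemma pw_pred: "\<alpha> (pw (i - 1) x) = pw i x"
  using pw_Suc[of "i - 1" x] by simp

lemma pw_pw: "pw i (pw j x) = pw (i + j) x"
proof (induction i rule: int_induct[where k = 0])
  case base show ?case by simp
next
  case (step1 i)
  have "pw (i + 1) (pw j x) = \<alpha> (pw (i + j) x)" using step1 by (simp add: pw_Suc)
  thus ?case using pw_Suc[of "i + j" x] by (simp add: algebra_simps)
next
  case (step2 i)
  have "\<alpha> (pw (i - 1) (pw j x)) = \<alpha> (pw (i - 1 + j) x)"
    using step2 pw_pred[of "i + j" x] pw_pred[of i "pw j x"] by (simp add: algebra_simps)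
  thus ?case by (rule injD[OF inj])
qed

lemma pw_hom:
  "pw i (x + y) = pw i x + pw i y" "pw i (x * y) = pw i x * pw i y"
  "pw i 0 = 0" "pw i 1 = 1"
proof -
  show "pw i (x + y) = pw i x + pw i y"
  proof (induction i rule: int_induct[where k = 0])
    case (step2 i) show ?case
      by (rule injD[OF inj]) (simp add: step2 add pw_pred)
  qed (simp_all add: pw_Suc add)
  show "pw i (x * y) = pw i x * pw i y"
  proof (induction i rule: int_induct[where k = 0])
    case (step2 i) show ?case
      by (rule injD[OF inj]) (simp add: step2 mult pw_pred)
  qed (simp_all add: pw_Suc mult)
  show "pw i 0 = 0"
  proof (induction i rule: int_induct[where k = 0])
    case (step2 i) show ?case
      by (rule injD[OF inj]) (simp add: step2 pw_pred)
  qed (simp_all add: pw_Suc)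
  show "pw i 1 = 1"
  proof (induction i rule: int_induct[where k = 0])
    case (step2 i) show ?case
      by (rule injD[OF inj]) (simp add: step2 pw_pred)
  qed (simp_all add: pw_Suc)
qed

lemma pw_sum: "pw i (sum f A) = (\<Sum>a\<in>A. pw i (f a))"
  by (induction A rule: infinite_finite_induct) (simp_all add: pw_hom)

lemma pw_eq_0_iff [simp]: "pw i x = 0 \<longleftrightarrow> x = 0"
  using pw_pw[of "- i" i x] by (auto simp: pw_hom)


abbreviation star :: "'a fls \<Rightarrow> 'a fls \<Rightarrow> 'a fls" (infixl \<open>\<star>\<close> 70)
  where "f \<star> g \<equiv> skew_fls_times \<alpha> f g"

lemma star_nth_subdegree:
  "(f \<star> g) $$ n = (\<Sum>i=fls_subdegree f..n - fls_subdegree g. f $$ i * pw i (g $$ (n - i)))"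
  unfolding skew_fls_times_def
  by (rule nth_Abs_fls_ex_lower_bound)
     (intro exI[of _ "fls_subdegree f + fls_subdegree g"] allI impI, simp)

lemma star_nth:
  assumes "\<And>i. i < a \<Longrightarrow> f $$ i = 0" "\<And>i. i < b \<Longrightarrow> g $$ i = 0"
    and "c \<le> a" "n - b \<le> d"
  shows "(f \<star> g) $$ n = (\<Sum>i=c..d. f $$ i * pw i (g $$ (n - i)))"
proof -
  let ?t = "\<lambda>i. f $$ i * pw i (g $$ (n - i))"
  let ?S = "{i\<in>{min c (fls_subdegree f)..max d (n - fls_subdegree g)}. ?t i \<noteq> 0}"
  have mem: "a \<le> i" "i \<le> n - b" "fls_subdegree f \<le> i" "i \<le> n - fls_subdegree g" if "?t i \<noteq> 0" for i
  proof -
    from that have "f $$ i \<noteq> 0" "g $$ (n - i) \<noteq> 0" by (auto simp: pw_hom)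
    hence "\<not> i < a" "\<not> n - i < b" "\<not> i < fls_subdegree f" "\<not> n - i < fls_subdegree g"
      using assms(1)[of i] assms(2)[of "n - i"] fls_eq0_below_subdegree[of i f]
        fls_eq0_below_subdegree[of "n - i" g] by blast+
    thus "a \<le> i" "i \<le> n - b" "fls_subdegree f \<le> i" "i \<le> n - fls_subdegree g"
      by linarith+
  qed
  have "(f \<star> g) $$ n = sum ?t ?S" unfolding star_nth_subdegree
    by (rule sum.mono_neutral_right[symmetric, THEN sym]) (use mem in \<open>force+\<close>)
  also have "\<dots> = sum ?t {c..d}"
    by (rule sum.mono_neutral_left) (use mem assms in \<open>force+\<close>)
  finally show ?thesis .
qed

lemma star_zero [simp]: "0 \<star> f = 0" "f \<star> 0 = 0"
  by (auto intro!: fls_eqI simp: star_nth_subdegree pw_hom)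

lemma star_one [simp]: "1 \<star> f = f" "f \<star> 1 = f"
proof -
  show "1 \<star> f = f"
  proof (rule fls_eqI)
    fix n
    have "(1 \<star> f) $$ n = (\<Sum>i=min 0 (n - fls_subdegree f)..max 0 (n - fls_subdegree f). 1 $$ i * pw i (f $$ (n - i)))"
      by (rule star_nth[where a = 0 and b = "fls_subdegree f"]) auto
    also have "\<dots> = (\<Sum>i\<in>{0}. 1 $$ i * pw i (f $$ (n - i)))"
      by (rule sum.mono_neutral_right) auto
    finally show "(1 \<star> f) $$ n = f $$ n" by simp
  qed
  show "f \<star> 1 = f"
  proof (rule fls_eqI)
    fix n
    have "(f \<star> 1) $$ n = (\<Sum>i=min n (fls_subdegree f)..n. f $$ i * pw i (1 $$ (n - i)))"
      by (rule star_nth[where a = "fls_subdegree f" and b = 0]) auto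
    also have "\<dots> = (\<Sum>i\<in>{n}. f $$ i * pw i (1 $$ (n - i)))"
      by (rule sum.mono_neutral_right) (auto simp: pw_hom)
    finally show "(f \<star> 1) $$ n = f $$ n" by (simp add: pw_hom)
  qed
qed

lemma star_distrib: "f \<star> (g + h) = f \<star> g + f \<star> h" "(g + h) \<star> f = g \<star> f + h \<star> f"
proof -
  let ?b = "min (fls_subdegree g) (fls_subdegree h)" and ?a = "fls_subdegree f"
  note st = star_nth[where a = ?a and b = ?b and c = ?a, OF _ _ order_refl order_refl]
    and st' = star_nth[where a = ?b and b = ?a and c = ?b, OF _ _ order_refl order_refl]
  show "f \<star> (g + h) = f \<star> g + f \<star> h"
    by (intro fls_eqI) (simp add: st pw_hom ring_distribs sum.distrib)
  show "(g + h) \<star> f = g \<star> f + h \<star> f"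
    by (intro fls_eqI) (simp add: st' pw_hom ring_distribs sum.distrib)
qed

lemma star_assoc: "(f \<star> g) \<star> h = f \<star> (g \<star> h)"
proof (rule fls_eqI)
  fix n
  define a b c where abc: "a = fls_subdegree f" "b = fls_subdegree g" "c = fls_subdegree h"
  have 0: "\<And>i. i < a \<Longrightarrow> f $$ i = 0" "\<And>i. i < b \<Longrightarrow> g $$ i = 0" "\<And>i. i < c \<Longrightarrow> h $$ i = 0"
    by (simp_all add: abc)
  have fg: "(f \<star> g) $$ k = (\<Sum>i=a..n-b-c. f $$ i * pw i (g $$ (k - i)))" if "k \<le> n - c" for k
    by (rule star_nth[OF 0(1) 0(2)]) (use that in auto)
  have gh: "(g \<star> h) $$ k = (\<Sum>j=b..n-a-c. g $$ j * pw j (h $$ (k - j)))" if "k \<le> n - a" for k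
    by (rule star_nth[OF 0(2) 0(3)]) (use that in auto)
  have fg0: "(f \<star> g) $$ k = 0" if "k < a + b" for k
    using that by (simp add: star_nth_subdegree abc)
  have gh0: "(g \<star> h) $$ k = 0" if "k < b + c" for k
    using that by (simp add: star_nth_subdegree abc)
  let ?t = "\<lambda>i k. f $$ i * pw i (g $$ (k - i)) * pw k (h $$ (n - k))"
  have "((f \<star> g) \<star> h) $$ n = (\<Sum>k=a+b..n-c. (f \<star> g) $$ k * pw k (h $$ (n - k)))"
    by (rule star_nth[OF fg0 0(3)]) auto
  also have "\<dots> = (\<Sum>k=a+b..n-c. \<Sum>i=a..n-b-c. ?t i k)"
    by (intro sum.cong refl) (simp add: fg sum_distrib_right)
  also have "\<dots> = (\<Sum>i=a..n-b-c. \<Sum>k=a+b..n-c. ?t i k)" by (rule sum.swap)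
  also have "\<dots> = (\<Sum>i=a..n-b-c. f $$ i * pw i ((g \<star> h) $$ (n - i)))"
  proof (rule sum.cong[OF refl])
    fix i assume i: "i \<in> {a..n-b-c}"
    have "(\<Sum>k=a+b..n-c. ?t i k) = (\<Sum>k=i+b..n-c. ?t i k)"
      by (rule sum.mono_neutral_right) (use i 0(2) in \<open>auto simp: pw_hom\<close>)
    also have "\<dots> = (\<Sum>k=i+b..i+(n-a-c). ?t i k)"
      by (rule sum.mono_neutral_left) (use i 0(3) in \<open>auto simp: pw_hom\<close>)
    also have "\<dots> = (\<Sum>j=b..n-a-c. ?t i (i + j))"
      by (rule sum.reindex_bij_witness[of _ "\<lambda>j. i + j" "\<lambda>k. k - i"]) auto
    also have "\<dots> = f $$ i * pw i ((g \<star> h) $$ (n - i))"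
      using i by (simp add: gh pw_sum pw_hom pw_pw sum_distrib_left mult.assoc algebra_simps)
    finally show "(\<Sum>k=a+b..n-c. ?t i k) = f $$ i * pw i ((g \<star> h) $$ (n - i))" .
  qed
  also have "\<dots> = (f \<star> (g \<star> h)) $$ n"
    by (rule star_nth[OF 0(1) gh0, symmetric]) auto
  finally show "((f \<star> g) \<star> h) $$ n = (f \<star> (g \<star> h)) $$ n" .
qed

lemma skew_fls_simps [simp]:
  "carrier (skew_fls \<alpha>) = UNIV" "x \<otimes>\<^bsub>skew_fls \<alpha>\<^esub> y = x \<star> y" "\<one>\<^bsub>skew_fls \<alpha>\<^esub> = 1"
  "\<zero>\<^bsub>skew_fls \<alpha>\<^esub> = 0" "x \<oplus>\<^bsub>skew_fls \<alpha>\<^esub> y = x + y"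
  by (simp_all add: skew_fls_def)

theorem ring_skew_fls: "ring (skew_fls \<alpha>)"
proof (rule ringI)
  show "abelian_group (skew_fls \<alpha>)"
    by (rule abelian_groupI) (auto simp: ac_simps intro: exI[of _ "- x" for x])
  show "monoid (skew_fls \<alpha>)"
    by (rule monoidI) (auto simp: star_assoc)
qed (auto simp: star_distrib)

fun rinv_coeff :: "'a fls \<Rightarrow> nat \<Rightarrow> 'a" where
  "rinv_coeff f k = pw (- fls_subdegree f)
     (((if k = 0 then 1 else 0) -
        (\<Sum>i\<in>{1..k}. f $$ (fls_subdegree f + int i) *
            pw (fls_subdegree f + int i) (rinv_coeff f (k - i)))) / f $$ fls_subdegree f)"

declare rinv_coeff.simps [simp del]

lemma right_inverse_exists:
  assumes "f \<noteq> 0"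
  shows "\<exists>g. f \<star> g = 1"
proof -
  define d where "d = fls_subdegree f"
  define g where "g = Abs_fls (\<lambda>n. if n < - d then 0 else rinv_coeff f (nat (n + d)))"
  have g: "g $$ n = (if n < - d then 0 else rinv_coeff f (nat (n + d)))" for n
    unfolding g_def by (rule nth_Abs_fls_ex_lower_bound) auto
  have nz: "f $$ d \<noteq> 0" using assms by (simp add: d_def)
  have "(f \<star> g) $$ n = (if n = 0 then 1 else 0)" for n
  proof -
    have *: "(f \<star> g) $$ n = (\<Sum>i=d..n+d. f $$ i * pw i (g $$ (n - i)))"
      by (rule star_nth[where a = d and b = "-d"]) (auto simp: d_def g)
    show ?thesis
    proof (cases "n < 0")
      case False
      then obtain k where k: "n = int k" by (metis nat_0_le not_less)
      have idx: "nat (int k - a + d) = k - nat (a - d)" if "d \<le> a" for a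
        using that by linarith
      have "(\<Sum>i=d..n+d. f $$ i * pw i (g $$ (n - i))) =
            (\<Sum>i\<in>{0..k}. f $$ (d + int i) * pw (d + int i) (rinv_coeff f (k - i)))"
        by (rule sum.reindex_bij_witness[of _ "\<lambda>i. d + int i" "\<lambda>i. nat (i - d)"])
           (auto simp: g k idx)
      also have "\<dots> = f $$ d * pw d (rinv_coeff f k) +
            (\<Sum>i\<in>{1..k}. f $$ (d + int i) * pw (d + int i) (rinv_coeff f (k - i)))"
        by (subst sum.atLeast_Suc_atMost) auto
      also have "pw d (rinv_coeff f k) = ((if k = 0 then 1 else 0) -
            (\<Sum>i\<in>{1..k}. f $$ (d + int i) * pw (d + int i) (rinv_coeff f (k - i)))) / f $$ d"
        by (subst rinv_coeff.simps) (simp add: d_def[symmetric] pw_pw)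
      finally show ?thesis using nz * k by simp
    qed (simp add: *)
  qed
  hence "f \<star> g = 1" by (intro fls_eqI) auto
  thus ?thesis by blast
qed

lemma inverse_exists:
  assumes "f \<noteq> 0"
  shows "\<exists>g. f \<star> g = 1 \<and> g \<star> f = 1"
proof -
  obtain g where g: "f \<star> g = 1" using right_inverse_exists[OF assms] by blast
  hence "g \<noteq> 0" by auto
  then obtain h where h: "g \<star> h = 1" using right_inverse_exists by blast
  have "f = (f \<star> g) \<star> h" by (simp add: star_assoc h)
  with g h show ?thesis by auto
qed

theorem Units_skew_fls: "Units (skew_fls \<alpha>) = UNIV - {0}"
  using inverse_exists by (force simp: Units_def)

lemma inv_star:
  assumes "f \<noteq> 0"
  shows "f \<star> inv\<^bsub>skew_fls \<alpha>\<^esub> f = 1" "inv\<^bsub>skew_fls \<alpha>\<^esub> f \<star> f = 1"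
proof -
  interpret ring "skew_fls \<alpha>" by (rule ring_skew_fls)
  have "f \<in> Units (skew_fls \<alpha>)" using assms by (simp add: Units_skew_fls)
  from Units_r_inv[OF this] Units_l_inv[OF this]
  show "f \<star> inv\<^bsub>skew_fls \<alpha>\<^esub> f = 1" "inv\<^bsub>skew_fls \<alpha>\<^esub> f \<star> f = 1" by simp_all
qed

lemma star_eq_0_iff: "f \<star> g = 0 \<longleftrightarrow> f = 0 \<or> g = 0"
proof
  assume fg: "f \<star> g = 0"
  show "f = 0 \<or> g = 0"
  proof (rule disjCI)
    assume "g \<noteq> 0"
    then obtain h where "g \<star> h = 1" using right_inverse_exists by blast
    hence "f = (f \<star> g) \<star> h" by (simp add: star_assoc)
    thus "f = 0" by (simp add: fg)
  qed
qed auto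

text \<open>The commutation rule $x r = \alpha(r) x$.\<close>

lemma skew_commute: "fls_X \<star> fls_const r = fls_const (\<alpha> r) \<star> fls_X"
proof (rule fls_eqI)
  fix n
  have "(fls_X \<star> fls_const r) $$ n = (\<Sum>i=min 1 n..max 1 n. fls_X $$ i * pw i (fls_const r $$ (n - i)))"
    by (rule star_nth[where a = 1 and b = 0]) auto
  also have "\<dots> = (\<Sum>i\<in>{1}. fls_X $$ i * pw i (fls_const r $$ (n - i)))"
    by (rule sum.mono_neutral_right) auto
  finally have 1: "(fls_X \<star> fls_const r) $$ n = (if n = 1 then \<alpha> r else 0)"
    using pw_of_nat[of 1] by (simp add: pw_hom)
  have "(fls_const (\<alpha> r) \<star> fls_X) $$ n =
      (\<Sum>i=min 0 n..max 0 n. fls_const (\<alpha> r) $$ i * pw i (fls_X $$ (n - i)))"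
    by (rule star_nth[where a = 0 and b = 1]) auto
  also have "\<dots> = (\<Sum>i\<in>{0}. fls_const (\<alpha> r) $$ i * pw i (fls_X $$ (n - i)))"
    by (rule sum.mono_neutral_right) auto
  finally show "(fls_X \<star> fls_const r) $$ n = (fls_const (\<alpha> r) \<star> fls_X) $$ n"
    using 1 by simp
qed

lemma coeff_skew_poly_times:
  "coeff (skew_poly_times \<alpha> p q) n = (\<Sum>i=0..n. coeff p i * (\<alpha> ^^ i) (coeff q (n - i)))"
proof -
  have z: "(\<alpha> ^^ i) 0 = 0" for i by (simp flip: pw_of_nat add: pw_hom)
  have "coeff (skew_poly_times \<alpha> p q) n =
      (\<Sum>i\<le>degree p. \<Sum>j\<le>degree q. if i + j = n then coeff p i * (\<alpha> ^^ i) (coeff q j) else 0)"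
    by (simp add: skew_poly_times_def coeff_sum)
  also have "\<dots> = (\<Sum>i\<le>degree p. if i \<le> n then coeff p i * (\<alpha> ^^ i) (coeff q (n - i)) else 0)"
  proof (rule sum.cong[OF refl])
    fix i
    show "(\<Sum>j\<le>degree q. if i + j = n then coeff p i * (\<alpha> ^^ i) (coeff q j) else 0) =
        (if i \<le> n then coeff p i * (\<alpha> ^^ i) (coeff q (n - i)) else 0)"
    proof (cases "i \<le> n")
      case True
      hence "(\<Sum>j\<le>degree q. if i + j = n then coeff p i * (\<alpha> ^^ i) (coeff q j) else 0) =
          (\<Sum>j\<le>degree q. if j = n - i then coeff p i * (\<alpha> ^^ i) (coeff q j) else 0)"
        by (intro sum.cong) auto
      thus ?thesis using True by (auto simp: coeff_eq_0 z)
    qed (auto intro: sum.neutral)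
  qed
  also have "\<dots> = (\<Sum>i\<in>{i\<in>{..degree p}. i \<le> n}. coeff p i * (\<alpha> ^^ i) (coeff q (n - i)))"
    by (rule sum.inter_filter[symmetric]) auto
  also have "\<dots> = (\<Sum>i=0..n. coeff p i * (\<alpha> ^^ i) (coeff q (n - i)))"
    by (rule sum.mono_neutral_left) (auto simp: le_degree)
  finally show ?thesis .
qed

lemma fps_to_fls_skew_times: "fps_to_fls (skew_fps_times \<alpha> f g) = fps_to_fls f \<star> fps_to_fls g"
proof (rule fls_eqI)
  fix n
  have *: "(fps_to_fls f \<star> fps_to_fls g) $$ n =
      (\<Sum>i=0..n. fps_to_fls f $$ i * pw i (fps_to_fls g $$ (n - i)))"
    by (rule star_nth[where a = 0 and b = 0]) auto
  show "fps_to_fls (skew_fps_times \<alpha> f g) $$ n = (fps_to_fls f \<star> fps_to_fls g) $$ n"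
  proof (cases "n < 0")
    case False
    then obtain k where k: "n = int k" by (metis nat_0_le not_less)
    have "(\<Sum>i=0..n. fps_to_fls f $$ i * pw i (fps_to_fls g $$ (n - i))) =
        (\<Sum>i=0..k. fps_nth f i * (\<alpha> ^^ i) (fps_nth g (k - i)))"
      by (rule sum.reindex_bij_witness[of _ int nat])
         (auto simp: k nat_diff_distrib simp flip: pw_of_nat)
    hence "(fps_to_fls f \<star> fps_to_fls g) $$ n =
        (\<Sum>i=0..k. fps_nth f i * (\<alpha> ^^ i) (fps_nth g (k - i)))" by (simp only: *)
    thus ?thesis by (simp add: k skew_fps_times_def)
  qed (simp add: *)
qed

lemma fps_of_poly_skew_times:
  "fps_of_poly (skew_poly_times \<alpha> p q) = skew_fps_times \<alpha> (fps_of_poly p) (fps_of_poly q)"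
  by (rule fps_ext) (simp add: coeff_skew_poly_times skew_fps_times_def)

lemma poly_to_fls_skew_times:
  "poly_to_fls (skew_poly_times \<alpha> p q) = poly_to_fls p \<star> poly_to_fls q"
  by (simp add: poly_to_fls_def fps_of_poly_skew_times fps_to_fls_skew_times)

lemma poly_to_fls_simps [simp]:
  "poly_to_fls 0 = 0" "poly_to_fls 1 = 1" "poly_to_fls (p + q) = poly_to_fls p + poly_to_fls q"
  "poly_to_fls (- p) = - poly_to_fls p" "poly_to_fls p = poly_to_fls q \<longleftrightarrow> p = q"
  "poly_to_fls p = 0 \<longleftrightarrow> p = 0"
  by (simp_all add: poly_to_fls_def fps_of_poly_add fps_of_poly_uminus fps_of_poly_eq_iff
        fls_uminus_nth fls_eqI)

theorem ring_skew_fps: "ring (skew_fps \<alpha>)"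
proof (rule ringI)
  show "abelian_group (skew_fps \<alpha>)"
    by (rule abelian_groupI)
       (auto simp: skew_fps_def ac_simps intro: exI[of _ "- x" for x])
  show "monoid (skew_fps \<alpha>)"
    by (rule monoidI)
       (auto simp: skew_fps_def star_assoc fps_to_fls_skew_times simp flip: fps_to_fls_eq_iff)
qed (auto simp: skew_fps_def star_distrib fps_to_fls_skew_times fps_to_fls_plus
       simp flip: fps_to_fls_eq_iff)

theorem ring_skew_poly: "ring (skew_poly \<alpha>)"
proof (rule ringI)
  show "abelian_group (skew_poly \<alpha>)"
    by (rule abelian_groupI)
       (auto simp: skew_poly_def ac_simps intro: exI[of _ "- x" for x])
  show "monoid (skew_poly \<alpha>)"
    by (rule monoidI)
       (auto simp: skew_poly_def star_assoc poly_to_fls_skew_times simp flip: poly_to_fls_simps(5))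
qed (auto simp: skew_poly_def star_distrib poly_to_fls_skew_times simp flip: poly_to_fls_simps(5))

theorem embeddings:
  "fps_of_poly \<in> ring_hom (skew_poly \<alpha>) (skew_fps \<alpha>)" "inj (fps_of_poly :: 'a poly \<Rightarrow> _)"
  "fps_to_fls \<in> ring_hom (skew_fps \<alpha>) (skew_fls \<alpha>)" "inj (fps_to_fls :: 'a fps \<Rightarrow> _)"
  by (auto simp: ring_hom_def skew_poly_def skew_fps_def fps_of_poly_skew_times fps_of_poly_add
        fps_to_fls_skew_times fps_to_fls_plus inj_def fps_of_poly_eq_iff)

lemma division_step:
  assumes "q \<noteq> 0"
  shows "\<exists>g r. poly_to_fls p = poly_to_fls g \<star> poly_to_fls q + poly_to_fls r \<and>
           (r = 0 \<or> degree r < degree q)"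
proof (induction "degree p" arbitrary: p rule: less_induct)
  case less
  show ?case
  proof (cases "p = 0 \<or> degree p < degree q")
    case True
    thus ?thesis by (intro exI[of _ 0] exI[of _ p]) auto
  next
    case False
    define k where "k = degree p - degree q"
    define m where "m = monom (lead_coeff p / (\<alpha> ^^ k) (lead_coeff q)) k"
    define p' where "p' = p - skew_poly_times \<alpha> m q"
    have nz: "(\<alpha> ^^ k) (lead_coeff q) \<noteq> 0" using assms by (simp flip: pw_of_nat)
    have mq: "coeff (skew_poly_times \<alpha> m q) n =
        (if k \<le> n then lead_coeff p / (\<alpha> ^^ k) (lead_coeff q) * (\<alpha> ^^ k) (coeff q (n - k)) else 0)" for n
    proof -
      have "coeff (skew_poly_times \<alpha> m q) n =
          (\<Sum>i=0..n. if i = k then lead_coeff p / (\<alpha> ^^ k) (lead_coeff q) * (\<alpha> ^^ k) (coeff q (n - k)) else 0)"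
        unfolding coeff_skew_poly_times m_def by (rule sum.cong) auto
      thus ?thesis by simp
    qed
    have z: "(\<alpha> ^^ i) 0 = 0" for i by (simp flip: pw_of_nat add: pw_hom)
    have top: "coeff p' (degree p) = 0"
      using False nz unfolding p'_def coeff_diff mq by (simp add: k_def)
    have "coeff p' n = 0" if "n > degree p" for n
    proof -
      have "n - k > degree q" using that False by (simp add: k_def)
      thus ?thesis using that unfolding p'_def coeff_diff mq by (simp add: coeff_eq_0 z)
    qed
    hence le: "degree p' \<le> degree p" by (intro degree_le) auto
    have eq: "poly_to_fls p = poly_to_fls m \<star> poly_to_fls q + poly_to_fls p'"
      unfolding poly_to_fls_skew_times[symmetric] poly_to_fls_simps(3)[symmetric] by (simp add: p'_def)
    show ?thesis
    proof (cases "p' = 0")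
      case True
      thus ?thesis using eq by (intro exI[of _ m] exI[of _ 0]) simp
    next
      case nz': False
      hence "degree p' < degree p" using top le by (metis le_neq_implies_less leading_coeff_0_iff)
      from less[OF this] obtain g r where
        gr: "poly_to_fls p' = poly_to_fls g \<star> poly_to_fls q + poly_to_fls r" "r = 0 \<or> degree r < degree q"
        by blast
      have "poly_to_fls p = poly_to_fls (m + g) \<star> poly_to_fls q + poly_to_fls r"
        using eq gr by (simp add: star_distrib algebra_simps)
      with gr(2) show ?thesis by blast
    qed
  qed
qed

lemma ore_condition:
  assumes "q \<noteq> 0"
  shows "\<exists>u v. u \<noteq> 0 \<and> poly_to_fls u \<star> poly_to_fls p = poly_to_fls v \<star> poly_to_fls q"
  using assms
proof (induction "degree q" arbitrary: p q rule: less_induct)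
  case less
  obtain g r where
    gr: "poly_to_fls p = poly_to_fls g \<star> poly_to_fls q + poly_to_fls r" "r = 0 \<or> degree r < degree q"
    using division_step[OF less.prems] by blast
  show ?case
  proof (cases "r = 0")
    case True
    thus ?thesis using gr by (intro exI[of _ 1] exI[of _ g]) simp
  next
    case False
    with gr(2) have "degree r < degree q" by simp
    from less.hyps[OF this False, of q] obtain u v where
      uv: "u \<noteq> 0" "poly_to_fls u \<star> poly_to_fls q = poly_to_fls v \<star> poly_to_fls r" by blast
    have "v \<noteq> 0"
    proof
      assume "v = 0"
      with uv(2) have "poly_to_fls u \<star> poly_to_fls q = 0" by simp
      thus False using uv(1) less.prems by (simp add: star_eq_0_iff)
    qed
    moreover have "poly_to_fls v \<star> poly_to_fls p =
        poly_to_fls (skew_poly_times \<alpha> v g + u) \<star> poly_to_fls q"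
      by (simp add: gr(1) star_distrib star_assoc poly_to_fls_skew_times uv(2))
    ultimately show ?thesis by blast
  qed
qed

lemma eq_skew_fraction_iff:
  assumes "q \<noteq> 0"
  shows "f = skew_fraction \<alpha> q p \<longleftrightarrow> poly_to_fls q \<star> f = poly_to_fls p"
proof
  note q = inv_star[of "poly_to_fls q"]
  show "poly_to_fls q \<star> f = poly_to_fls p" if "f = skew_fraction \<alpha> q p"
    using q assms that by (simp add: skew_fraction_def flip: star_assoc)
  show "f = skew_fraction \<alpha> q p" if "poly_to_fls q \<star> f = poly_to_fls p"
  proof -
    have "skew_fraction \<alpha> q p = inv\<^bsub>skew_fls \<alpha>\<^esub> (poly_to_fls q) \<star> poly_to_fls q \<star> f"
      using that by (simp add: skew_fraction_def star_assoc)
    thus ?thesis using q assms by simp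
  qed
qed

lemma mem_skew_ratfun_iff:
  "f \<in> carrier (skew_ratfun \<alpha>) \<longleftrightarrow>
     (\<exists>q p. q \<noteq> 0 \<and> poly_to_fls q \<star> f = poly_to_fls p)"
  using eq_skew_fraction_iff by (fastforce simp: skew_ratfun_def)

theorem subring_skew_ratfun: "subring (carrier (skew_ratfun \<alpha>)) (skew_fls \<alpha>)"
proof -
  interpret ring "skew_fls \<alpha>" by (rule ring_skew_fls)
  have uminus: "\<ominus>\<^bsub>skew_fls \<alpha>\<^esub> f = - f" for f
    using minus_equality[of "- f" f] by simp
  have star_minus: "g \<star> (- f) = - (g \<star> f)" for f g
    using star_distrib(1)[of g f "- f"] by (simp add: eq_neg_iff_add_eq_0 add.commute)
  show ?thesis
  proof (rule subringI)
    show "\<one>\<^bsub>skew_fls \<alpha>\<^esub> \<in> carrier (skew_ratfun \<alpha>)"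
      unfolding mem_skew_ratfun_iff by (intro exI[of _ 1]) simp
  next
    fix f assume "f \<in> carrier (skew_ratfun \<alpha>)"
    then obtain q p where "q \<noteq> 0" "poly_to_fls q \<star> f = poly_to_fls p"
      unfolding mem_skew_ratfun_iff by blast
    thus "\<ominus>\<^bsub>skew_fls \<alpha>\<^esub> f \<in> carrier (skew_ratfun \<alpha>)"
      unfolding mem_skew_ratfun_iff uminus
      by (intro exI[of _ q] exI[of _ "- p"]) (simp add: star_minus)
  next
    fix f g assume "f \<in> carrier (skew_ratfun \<alpha>)" "g \<in> carrier (skew_ratfun \<alpha>)"
    then obtain q p q' p' where
      f: "q \<noteq> 0" "poly_to_fls q \<star> f = poly_to_fls p" and
      g: "q' \<noteq> 0" "poly_to_fls q' \<star> g = poly_to_fls p'"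
      unfolding mem_skew_ratfun_iff by blast
    obtain u v where uv: "u \<noteq> 0" "poly_to_fls u \<star> poly_to_fls p = poly_to_fls v \<star> poly_to_fls q'"
      using ore_condition[OF g(1)] by blast
    have "poly_to_fls (skew_poly_times \<alpha> u q) \<star> (f \<star> g) = poly_to_fls u \<star> (poly_to_fls q \<star> f) \<star> g"
      by (simp add: poly_to_fls_skew_times star_assoc)
    also have "\<dots> = poly_to_fls (skew_poly_times \<alpha> v p')"
      by (simp add: f(2) uv(2) star_assoc g(2) poly_to_fls_skew_times)
    finally have "poly_to_fls (skew_poly_times \<alpha> u q) \<star> (f \<star> g) = poly_to_fls (skew_poly_times \<alpha> v p')" .
    moreover have "skew_poly_times \<alpha> u q \<noteq> 0"
      using uv(1) f(1) by (simp add: poly_to_fls_skew_times star_eq_0_iff flip: poly_to_fls_simps(6))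
    ultimately show "f \<otimes>\<^bsub>skew_fls \<alpha>\<^esub> g \<in> carrier (skew_ratfun \<alpha>)"
      unfolding mem_skew_ratfun_iff skew_fls_simps by blast
    obtain u v where uv: "u \<noteq> 0" "poly_to_fls u \<star> poly_to_fls q = poly_to_fls v \<star> poly_to_fls q'"
      using ore_condition[OF g(1)] by blast
    have "poly_to_fls (skew_poly_times \<alpha> u q) \<star> (f + g) =
        poly_to_fls u \<star> (poly_to_fls q \<star> f) + poly_to_fls v \<star> (poly_to_fls q' \<star> g)"
      by (simp add: poly_to_fls_skew_times star_distrib uv(2) flip: star_assoc)
    also have "\<dots> = poly_to_fls (skew_poly_times \<alpha> u p + skew_poly_times \<alpha> v p')"
      by (simp add: f(2) g(2) poly_to_fls_skew_times)
    finally have "poly_to_fls (skew_poly_times \<alpha> u q) \<star> (f + g) =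
        poly_to_fls (skew_poly_times \<alpha> u p + skew_poly_times \<alpha> v p')" .
    moreover have "skew_poly_times \<alpha> u q \<noteq> 0"
      using uv(1) f(1) by (simp add: poly_to_fls_skew_times star_eq_0_iff flip: poly_to_fls_simps(6))
    ultimately show "f \<oplus>\<^bsub>skew_fls \<alpha>\<^esub> g \<in> carrier (skew_ratfun \<alpha>)"
      unfolding mem_skew_ratfun_iff skew_fls_simps by blast
  qed simp
qed

lemma skew_ratfun_simps [simp]:
  "x \<otimes>\<^bsub>skew_ratfun \<alpha>\<^esub> y = x \<star> y" "\<one>\<^bsub>skew_ratfun \<alpha>\<^esub> = 1" "\<zero>\<^bsub>skew_ratfun \<alpha>\<^esub> = 0"
  by (simp_all add: skew_ratfun_def skew_fls_def)

text \<open>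
  $K(x;\alpha)$ is a division ring which contains $K[x;\alpha]$ and in which every element is a
  left fraction of elements of $K[x;\alpha]$.
\<close>

theorem ring_skew_ratfun: "ring (skew_ratfun \<alpha>)"
proof -
  have "skew_ratfun \<alpha> = (skew_fls \<alpha>) \<lparr>carrier := carrier (skew_ratfun \<alpha>)\<rparr>"
    by (simp add: skew_ratfun_def)
  thus ?thesis
    using ring.subring_is_ring[OF ring_skew_fls subring_skew_ratfun] by simp
qed

theorem Units_skew_ratfun: "Units (skew_ratfun \<alpha>) = carrier (skew_ratfun \<alpha>) - {0}"
proof (intro equalityI subsetI)
  fix f assume "f \<in> Units (skew_ratfun \<alpha>)"
  thus "f \<in> carrier (skew_ratfun \<alpha>) - {0}" by (auto simp: Units_def)
next
  fix f assume "f \<in> carrier (skew_ratfun \<alpha>) - {0}"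
  hence f: "f \<in> carrier (skew_ratfun \<alpha>)" "f \<noteq> 0" by simp_all
  from f(1) obtain q p where qp: "q \<noteq> 0" "poly_to_fls q \<star> f = poly_to_fls p"
    unfolding mem_skew_ratfun_iff by blast
  obtain g where g: "f \<star> g = 1" "g \<star> f = 1" using inverse_exists[OF f(2)] by blast
  have "p \<noteq> 0"
  proof
    assume "p = 0"
    with qp(2) have "poly_to_fls q \<star> f = 0" by simp
    thus False using qp(1) f by (simp add: star_eq_0_iff)
  qed
  moreover have "poly_to_fls p \<star> g = poly_to_fls q"
    by (simp add: star_assoc g flip: qp(2))
  ultimately have "g \<in> carrier (skew_ratfun \<alpha>)" unfolding mem_skew_ratfun_iff by blast
  with f g show "f \<in> Units (skew_ratfun \<alpha>)" by (auto simp: Units_def)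
qed

theorem poly_to_fls_in_skew_ratfun:
  "poly_to_fls \<in> ring_hom (skew_poly \<alpha>) (skew_ratfun \<alpha>)" "inj (poly_to_fls :: 'a poly \<Rightarrow> _)"
proof -
  have "poly_to_fls p \<in> carrier (skew_ratfun \<alpha>)" for p :: "'a poly"
    unfolding mem_skew_ratfun_iff by (intro exI[of _ 1] exI[of _ p]) simp
  thus "poly_to_fls \<in> ring_hom (skew_poly \<alpha>) (skew_ratfun \<alpha>)"
    by (auto simp: ring_hom_def skew_poly_def poly_to_fls_skew_times)
       (simp add: skew_ratfun_def)
qed (auto simp: inj_def)

end

end

theory Submission
  imports Defs
begin

text \<open>
  Multiplying a power series $A$ on the left by a skew polynomial $Q$ turns rationality into a
  family of linear equations: $A = Q^{-1}P$ means $QA = P$, and the coefficient of $x^k$ in $QA$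
  is $\sum_{i \le k} q_i \alpha^i(a_{k-i})$. Some polynomial $P$ of degree below $n$ satisfies
  $QA = P$ exactly when these sums vanish for all $k \ge n$ (\<open>skew_fraction_iff_eventually_annihilated\<close>).

  For $Q = 1 - \sum_{j=1}^n c_j x^j$ the vanishing of the $k$-th sum, $k \ge n$, is literally the
  recurrence for $a_k$ (\<open>recurrence_iff_skew_fraction\<close>). This gives the second half of the theorem
  and one direction of the equivalence.

  Conversely, an arbitrary denominator $Q \neq 0$ need not have constant term $1$, or even a
  nonzero one. If $x^m$ is the lowest power of $x$ that occurs in $Q$, applying
  $\alpha^{-m}$ to the equation for $k = i + n + m$ turns its lowest term into a nonzero multiple
  of $a_{i+n}$ itself, and dividing by that multiple leaves a recurrence whose constants do not
  depend on $i$ (\<open>skew_fraction_imp_recurrence\<close>). In terms of polynomials, this writes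
  $Q = q_m x^m Q'$ with $Q'$ of constant term $1$; pulling $x^m$ out to the left of the
  coefficients of $Q'$ is possible because $\alpha$ is invertible.
\<close>

definition skew_recurrence :: "('a::field \<Rightarrow> 'a) \<Rightarrow> nat \<Rightarrow> (nat \<Rightarrow> 'a) \<Rightarrow> 'a fps \<Rightarrow> bool" where
  "skew_recurrence \<alpha> n c A \<longleftrightarrow>
     (\<forall>i. fps_nth A (i + n) = (\<Sum>j=1..n. c j * (\<alpha> ^^ j) (fps_nth A (i + (n - j)))))"

definition recurrence_denominator :: "nat \<Rightarrow> (nat \<Rightarrow> 'a::field) \<Rightarrow> 'a poly" where
  "recurrence_denominator n c = 1 - (\<Sum>i=1..n. monom (c i) i)"

lemma coeff_recurrence_denominator:
  "coeff (recurrence_denominator n c) i =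
     (if i = 0 then 1 else if i \<le> n then - c i else 0)"
proof -
  have "coeff (\<Sum>j=1..n. monom (c j) j) i = (\<Sum>j=1..n. if i = j then c j else 0)"
    unfolding coeff_sum by (intro sum.cong) auto
  thus ?thesis by (auto simp: recurrence_denominator_def)
qed

lemma recurrence_denominator_nonzero: "recurrence_denominator n c \<noteq> 0"
  using coeff_recurrence_denominator[of n c 0] by auto

context field_automorphism
begin

lemma represents_skew_fraction_iff_coeff:
  assumes "Q \<noteq> 0"
  shows "represents A (skew_fraction \<alpha> Q P) \<longleftrightarrow>
           (\<forall>k. (\<Sum>i=0..k. coeff Q i * (\<alpha> ^^ i) (fps_nth A (k - i))) = coeff P k)"
proof -
  have "represents A (skew_fraction \<alpha> Q P) \<longleftrightarrow> skew_fps_times \<alpha> (fps_of_poly Q) A = fps_of_poly P"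
    by (simp add: represents_def eq_skew_fraction_iff[OF assms] poly_to_fls_def
          flip: fps_to_fls_skew_times)
  also have "\<dots> \<longleftrightarrow>
      (\<forall>k. (\<Sum>i=0..k. coeff Q i * (\<alpha> ^^ i) (fps_nth A (k - i))) = coeff P k)"
    by (simp add: fps_eq_iff skew_fps_times_def)
  finally show ?thesis .
qed

text \<open>
  The numerator is determined by $Q$ and $A$: it is the product $QA$, which is a polynomial
  as soon as its coefficients vanish from some index on.
\<close>

lemma skew_fraction_iff_eventually_annihilated:
  assumes "Q \<noteq> 0" "n \<ge> 1"
  shows "(\<exists>P. degree P \<le> n - 1 \<and> represents A (skew_fraction \<alpha> Q P)) \<longleftrightarrow>
           (\<forall>k\<ge>n. (\<Sum>i=0..k. coeff Q i * (\<alpha> ^^ i) (fps_nth A (k - i))) = 0)"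
    (is "_ \<longleftrightarrow> (\<forall>k\<ge>n. ?s k = 0)")
proof
  assume "\<exists>P. degree P \<le> n - 1 \<and> represents A (skew_fraction \<alpha> Q P)"
  then obtain P where P: "degree P \<le> n - 1" "\<And>k. ?s k = coeff P k"
    using represents_skew_fraction_iff_coeff[OF assms(1)] by blast
  show "\<forall>k\<ge>n. ?s k = 0"
    unfolding P(2) using P(1) assms(2) by (auto intro: coeff_eq_0)
next
  assume vanish: "\<forall>k\<ge>n. ?s k = 0"
  define P where "P = (\<Sum>k<n. monom (?s k) k)"
  have coeff: "coeff P k = ?s k" for k
  proof -
    have "coeff P k = (\<Sum>j<n. if j = k then ?s k else 0)"
      unfolding P_def coeff_sum by (intro sum.cong) auto
    thus ?thesis using vanish by simp
  qed
  have "degree P \<le> n - 1"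
    unfolding P_def using assms(2)
    by (intro degree_sum_le) (auto intro: order_trans[OF degree_monom_le])
  thus "\<exists>P. degree P \<le> n - 1 \<and> represents A (skew_fraction \<alpha> Q P)"
    using represents_skew_fraction_iff_coeff[OF assms(1)] coeff by auto
qed

text \<open>
  For $Q = 1 - \sum_j c_j x^j$, the coefficient of $x^{i+n}$ in $QA$ is the difference of the
  two sides of the recurrence.
\<close>

lemma recurrence_iff_skew_fraction:
  assumes "n \<ge> 1"
  shows "skew_recurrence \<alpha> n c A \<longleftrightarrow>
           (\<exists>P. degree P \<le> n - 1 \<and>
                represents A (skew_fraction \<alpha> (recurrence_denominator n c) P))"
proof -
  let ?Q = "recurrence_denominator n c"
  have "(\<Sum>j=0..i+n. coeff ?Q j * (\<alpha> ^^ j) (fps_nth A (i + n - j))) =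
      fps_nth A (i + n) - (\<Sum>j=1..n. c j * (\<alpha> ^^ j) (fps_nth A (i + (n - j))))" for i
  proof -
    have "(\<Sum>j=0..i+n. coeff ?Q j * (\<alpha> ^^ j) (fps_nth A (i + n - j))) =
        (\<Sum>j=0..n. coeff ?Q j * (\<alpha> ^^ j) (fps_nth A (i + n - j)))"
      by (rule sum.mono_neutral_right) (auto simp: coeff_recurrence_denominator)
    also have "\<dots> = fps_nth A (i + n) +
        (\<Sum>j=1..n. coeff ?Q j * (\<alpha> ^^ j) (fps_nth A (i + n - j)))"
      by (subst sum.atLeast_Suc_atMost) (simp_all add: coeff_recurrence_denominator)
    also have "(\<Sum>j=1..n. coeff ?Q j * (\<alpha> ^^ j) (fps_nth A (i + n - j))) =
        (\<Sum>j=1..n. - (c j * (\<alpha> ^^ j) (fps_nth A (i + (n - j)))))"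
      by (intro sum.cong) (auto simp: coeff_recurrence_denominator)
    finally show ?thesis by (simp add: sum_negf)
  qed
  hence "skew_recurrence \<alpha> n c A \<longleftrightarrow>
      (\<forall>i. (\<Sum>j=0..i+n. coeff ?Q j * (\<alpha> ^^ j) (fps_nth A (i + n - j))) = 0)"
    unfolding skew_recurrence_def by (simp only: right_minus_eq)
  also have "\<dots> \<longleftrightarrow> (\<forall>k\<ge>n. (\<Sum>j=0..k. coeff ?Q j * (\<alpha> ^^ j) (fps_nth A (k - j))) = 0)"
    by (auto simp: le_iff_add add.commute[of n])
  finally show ?thesis
    using skew_fraction_iff_eventually_annihilated[OF recurrence_denominator_nonzero assms]
    by simp
qed

text \<open>
  The lowest term $q_m x^m$ of $Q$ need not be the constant term $1$. Twisting by
  $\alpha^{-m}$ undoes the action of $x^m$ and makes every equation solvable for the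
  coefficient of $A$ of highest index.
\<close>

lemma skew_fraction_imp_recurrence:
  assumes "Q \<noteq> 0" "represents A (skew_fraction \<alpha> Q P)"
  shows "\<exists>n\<ge>1. \<exists>c. skew_recurrence \<alpha> n c A"
proof -
  define m where "m = (LEAST m. coeff Q m \<noteq> 0)"
  have nz: "coeff Q m \<noteq> 0"
    unfolding m_def by (rule LeastI[of _ "degree Q"]) (use assms(1) in simp)
  have below: "coeff Q j = 0" if "j < m" for j
    using not_less_Least[of j "\<lambda>m. coeff Q m \<noteq> 0"] that by (auto simp: m_def)
  define d where "d j = pw (- int m) (coeff Q (m + j))" for j
  have d0: "d 0 \<noteq> 0" using nz by (simp add: d_def)
  define c where "c j = - d j / d 0" for j
  \<comment> \<open>Above \<open>degree P\<close> the coefficients of \<open>Q A\<close> vanish, and above \<open>degree Q\<close> those of \<open>Q\<close>.\<close>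
  define n where "n = Suc (max (degree P) (degree Q))"
  have above: "coeff Q j = 0" if "j > m + n" for j
    using that by (intro coeff_eq_0) (simp add: n_def)
  have "fps_nth A (i + n) = (\<Sum>j=1..n. c j * (\<alpha> ^^ j) (fps_nth A (i + (n - j))))" for i
  proof -
    let ?t = "\<lambda>j. coeff Q j * (\<alpha> ^^ j) (fps_nth A (i + n + m - j))"
    have "(\<Sum>j=0..i+n+m. ?t j) = coeff P (i + n + m)"
      using assms represents_skew_fraction_iff_coeff by blast
    also have "\<dots> = 0" by (rule coeff_eq_0) (simp add: n_def)
    also have "(\<Sum>j=0..i+n+m. ?t j) = (\<Sum>j=m..m+n. ?t j)"
      by (rule sum.mono_neutral_right) (use below above in \<open>auto simp: not_le\<close>)
    also have "\<dots> = (\<Sum>j=0..n. ?t (m + j))"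
      by (rule sum.reindex_bij_witness[of _ "\<lambda>j. m + j" "\<lambda>j. j - m"]) auto
    finally have "0 = pw (- int m) (\<Sum>j=0..n. ?t (m + j))" by (simp add: pw_hom)
    also have "\<dots> = (\<Sum>j=0..n. d j * (\<alpha> ^^ j) (fps_nth A (i + (n - j))))"
      unfolding pw_sum
      by (intro sum.cong) (auto simp: pw_hom d_def pw_pw simp flip: pw_of_nat)
    also have "\<dots> = d 0 * fps_nth A (i + n) +
        (\<Sum>j=1..n. d j * (\<alpha> ^^ j) (fps_nth A (i + (n - j))))"
      by (subst sum.atLeast_Suc_atMost) simp_all
    finally have "d 0 * fps_nth A (i + n) =
        - (\<Sum>j=1..n. d j * (\<alpha> ^^ j) (fps_nth A (i + (n - j))))"
      by (simp add: eq_neg_iff_add_eq_0)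
    also have "\<dots> = d 0 * (\<Sum>j=1..n. c j * (\<alpha> ^^ j) (fps_nth A (i + (n - j))))"
      using d0 by (simp add: c_def sum_distrib_left flip: sum_negf)
    finally show ?thesis using d0 by simp
  qed
  moreover have "n \<ge> 1" by (simp add: n_def)
  ultimately show ?thesis unfolding skew_recurrence_def by blast
qed

end

theorem theorem1p3p5:
  fixes \<alpha> :: "'a::field \<Rightarrow> 'a" and A :: "'a fps"
  assumes "field_automorphism \<alpha>"
  shows "((\<exists>r\<in>carrier (skew_ratfun \<alpha>). represents A r) \<longleftrightarrow>
            (\<exists>n\<ge>1. \<exists>c :: nat \<Rightarrow> 'a. \<forall>i.
               fps_nth A (i + n) = (\<Sum>j=1..n. c j * (\<alpha> ^^ j) (fps_nth A (i + (n - j)))))) \<and>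
         (\<forall>n\<ge>1. \<forall>c :: nat \<Rightarrow> 'a.
            (\<forall>i. fps_nth A (i + n) = (\<Sum>j=1..n. c j * (\<alpha> ^^ j) (fps_nth A (i + (n - j))))) \<longrightarrow>
            (\<exists>P Q. degree P \<le> n - 1 \<and> Q = 1 - (\<Sum>i=1..n. monom (c i) i) \<and> Q \<noteq> 0 \<and>
                   represents A (skew_fraction \<alpha> Q P)))"
proof -
  interpret field_automorphism \<alpha> by (rule assms)
  have carrier: "(\<exists>r\<in>carrier (skew_ratfun \<alpha>). represents A r) \<longleftrightarrow>
      (\<exists>Q P. Q \<noteq> 0 \<and> represents A (skew_fraction \<alpha> Q P))"
    by (auto simp: skew_ratfun_def)
  have fraction: "\<exists>P Q. degree P \<le> n - 1 \<and> Q = recurrence_denominator n c \<and> Q \<noteq> 0 \<and>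
      represents A (skew_fraction \<alpha> Q P)" if "n \<ge> 1" "skew_recurrence \<alpha> n c A" for n c
    using recurrence_iff_skew_fraction[OF that(1)] that(2) recurrence_denominator_nonzero by blast
  have "(\<exists>r\<in>carrier (skew_ratfun \<alpha>). represents A r) \<longleftrightarrow>
      (\<exists>n\<ge>1. \<exists>c. skew_recurrence \<alpha> n c A)"
    unfolding carrier using skew_fraction_imp_recurrence fraction by blast
  with fraction show ?thesis
    unfolding skew_recurrence_def recurrence_denominator_def by blast
qed

end
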